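(* Let $\{X_i:i\in I\}$ be a family of topological spaces, each of countable $\pi$-character, such that for every $i\in I$ player two has a winning strategy in the game $G^\omega_1(\mathcal{C}_{X_i},\mathcal{D}_{X_i})$. Let $X=\prod_{i\in I}X_i$ with the product topology. Then player two has a winning strategy in the game $G^\omega_1(\mathcal{C}_X,\mathcal{D}_X)$.
   Context: A space has countable $\pi$-character if every point has a countable local $\pi$-base. For an ordinal $\alpha$ and collections of sets $\mathcal{A},\mathcal{B}$, $G^\alpha_1(\mathcal{A},\mathcal{B})$ denotes the two-player game of length $\alpha$ in which, at inning $\beta<\alpha$, player one chooses $\mathcal{U}_\beta\in\mathcal{A}$ and player two responds with an element $V_\beta\in\mathcal{U}_\beta$. Player two wins if and only if $\{V_\beta:\beta<\alpha\}\in\mathcal{B}$. For a topological space $X$: $\mathcal{C}_X$ is the collection of all maximal families of pairwise disjoint non-empty open subsets of $X$, and $\mathcal{D}_X$ is the collection of all families $\mathcal{U}$ of open subsets of $X$ such that $\bigcup\mathcal{U}$ is dense in $X$. *)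

theory Defs
  imports "HOL-Analysis.Analysis"
begin

text \<open>Members of a local \<open>\<pi>\<close>-base at \<open>x\<close> need not contain \<open>x\<close>.\<close>

definition local_pi_base :: "'a topology \<Rightarrow> 'a \<Rightarrow> 'a set set \<Rightarrow> bool" where
  "local_pi_base X x \<B> \<longleftrightarrow>
     (\<forall>B\<in>\<B>. openin X B \<and> B \<noteq> {}) \<and>
     (\<forall>U. openin X U \<and> x \<in> U \<longrightarrow> (\<exists>B\<in>\<B>. B \<subseteq> U))"

definition countable_pi_character :: "'a topology \<Rightarrow> bool" where
  "countable_pi_character X \<longleftrightarrow>
     (\<forall>x\<in>topspace X. \<exists>\<B>. countable \<B> \<and> local_pi_base X x \<B>)"

definition cellular_family :: "'a topology \<Rightarrow> 'a set set \<Rightarrow> bool" where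
  "cellular_family X \<U> \<longleftrightarrow> (\<forall>U\<in>\<U>. openin X U \<and> U \<noteq> {}) \<and> pairwise disjnt \<U>"

definition max_cellular :: "'a topology \<Rightarrow> 'a set set set" where
  "max_cellular X =
     {\<U>. cellular_family X \<U> \<and> (\<forall>\<W>. cellular_family X \<W> \<and> \<U> \<subseteq> \<W> \<longrightarrow> \<W> = \<U>)}"

definition dense_open_families :: "'a topology \<Rightarrow> 'a set set set" where
  "dense_open_families X =
     {\<U>. (\<forall>U\<in>\<U>. openin X U) \<and> X closure_of (\<Union>\<U>) = topspace X}"

text \<open>The game \<open>G\<close> of length \<open>\<omega>\<close> on \<open>\<A>\<close>, \<open>\<B>\<close>. A strategy \<open>\<sigma>\<close> for player two maps the nonempty
  list \<open>[\<U> 0, \<dots>, \<U> n]\<close> of the moves made so far by player one to the reply in inning \<open>n\<close>;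
  it is winning if, against every sequence of legal moves of player one, all its
  replies are legal and the set of these replies belongs to \<open>\<B>\<close>.\<close>

definition reply :: "('e set list \<Rightarrow> 'e) \<Rightarrow> (nat \<Rightarrow> 'e set) \<Rightarrow> nat \<Rightarrow> 'e" where
  "reply \<sigma> \<U> n = \<sigma> (map \<U> [0..<Suc n])"

definition winning_strategy_two ::
    "'e set set \<Rightarrow> 'e set set \<Rightarrow> ('e set list \<Rightarrow> 'e) \<Rightarrow> bool" where
  "winning_strategy_two \<A> \<B> \<sigma> \<longleftrightarrow>
     (\<forall>\<U>. (\<forall>n. \<U> n \<in> \<A>) \<longrightarrow>
        (\<forall>n. reply \<sigma> \<U> n \<in> \<U> n) \<and> {reply \<sigma> \<U> n | n. True} \<in> \<B>)"

definition player_two_wins_G1_omega :: "'e set set \<Rightarrow> 'e set set \<Rightarrow> bool" where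
  "player_two_wins_G1_omega \<A> \<B> \<longleftrightarrow> (\<exists>\<sigma>. winning_strategy_two \<A> \<B> \<sigma>)"

end

theory Submission
  imports Defs
begin

text \<open>
  The proof passes through the open-open game on a space: in each inning the chooser names a
  non-empty open set \<open>U\<close>, the shrinker answers with a non-empty open \<open>V \<subseteq> U\<close>, and the chooser
  wins if the answers have dense union. This game is dual to the game on maximal cellular
  families: player two wins the latter if and only if the chooser wins the former. One
  direction is easy, because a maximal cellular family has a member that meets \<open>U\<close>
  (\<open>player_two_wins_if_open_open_winning\<close>). For the other, fix a position of player two's
  strategy. If every non-empty open set contained a non-empty open set that is never the
  strategy's next reply, then a maximal cellular family could be made of such sets, and the
  strategy would have no legal reply to it. So some open \<open>U\<close> has all its non-empty open subsets among the possible
  replies, and the chooser names that \<open>U\<close> (\<open>open_open_winning_if_player_two_wins\<close>).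

  It remains to combine winning strategies \<open>\<tau> i\<close> of the chooser in the factors into one in the
  product. Running one play in each factor is not enough: that would only make the union
  dense coordinate by coordinate, at different innings. Instead the chooser runs, in each factor, a
  whole tree of partial plays. A node of the tree is the finite list \<open>s\<close> of the innings at
  which its moves were made. In each inning the chooser takes finitely many coordinates, a node in
  each of them, and names the open box with the sides that the \<open>\<tau> i\<close> prescribe at these
  nodes. The bookkeeping ensures that every finite choice of nodes, at coordinates that occur in
  the supports of earlier answers, is eventually taken.

  Now let \<open>A\<close> be an open box. In each coordinate \<open>i\<close> some node \<open>s\<close> is decisive: in every
  inning that takes \<open>s\<close> at \<open>i\<close>, the answer meets \<open>A\<close> in coordinate \<open>i\<close>. Otherwise each node could be
  extended by an answer that misses \<open>A i\<close>, and the resulting branch would be a play that \<open>\<tau> i\<close>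
  loses (\<open>decisive_node\<close>). Take the inning that plays decisive nodes at all coordinates
  restricted both by \<open>A\<close> and by some answer. Its answer meets \<open>A\<close> in these coordinates, and in
  every other coordinate one of the two boxes is unrestricted.
\<close>

section \<open>Lists built move by move\<close>

text \<open>A strategy that is built from a strategy of another game has to recompute, from the moves
  \<open>xs\<close> alone, the position reached in the other game. Each entry of that position depends on the
  earlier entries and on the current move.\<close>

definition responses :: "('b list \<Rightarrow> 'a \<Rightarrow> 'b) \<Rightarrow> 'a list \<Rightarrow> 'b list" where
  "responses h xs = foldl (\<lambda>s x. s @ [h s x]) [] xs"

lemma responses_upt:
  "responses h (map V [0..<n]) = map (\<lambda>k. h (responses h (map V [0..<k])) (V k)) [0..<n]"
  by (induction n) (simp_all add: responses_def)

section \<open>Maximal cellular families\<close>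

lemma max_cellular_meets:
  assumes "\<F> \<in> max_cellular X" and U: "openin X U" "U \<noteq> {}"
  shows "\<exists>W\<in>\<F>. W \<inter> U \<noteq> {}"
proof (rule ccontr)
  assume miss: "\<not> ?thesis"
  have cell: "cellular_family X \<F>"
    and max: "\<And>\<W>. cellular_family X \<W> \<Longrightarrow> \<F> \<subseteq> \<W> \<Longrightarrow> \<W> = \<F>"
    using assms(1) by (auto simp: max_cellular_def)
  have "cellular_family X (insert U \<F>)"
    using cell U miss
    by (auto simp: cellular_family_def pairwise_insert disjnt_def Int_commute)
  then have "insert U \<F> = \<F>"
    using max by blast
  then show False
    using miss U(2) by blast
qed

text \<open>A disjoint family that is maximal only among the families of sets satisfying \<open>P\<close> is already
  maximal among all of them, because an open set disjoint from its members would contain a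
  further set satisfying \<open>P\<close>.\<close>

lemma max_cellular_within_pi_base:
  assumes base: "\<And>U. openin X U \<Longrightarrow> U \<noteq> {} \<Longrightarrow> \<exists>V. openin X V \<and> V \<noteq> {} \<and> V \<subseteq> U \<and> P V"
  shows "\<exists>\<F>\<in>max_cellular X. \<forall>V\<in>\<F>. P V"
proof -
  define \<A> where "\<A> = {\<F>. cellular_family X \<F> \<and> (\<forall>V\<in>\<F>. P V)}"
  have "\<exists>\<F>\<in>\<A>. \<forall>\<W>\<in>\<A>. \<F> \<subseteq> \<W> \<longrightarrow> \<W> = \<F>"
  proof (rule subset_Zorn')
    fix \<C> assume "subset.chain \<A> \<C>"
    then have sub: "\<C> \<subseteq> \<A>" and lin: "\<And>\<F> \<G>. \<F> \<in> \<C> \<Longrightarrow> \<G> \<in> \<C> \<Longrightarrow> \<F> \<subseteq> \<G> \<or> \<G> \<subseteq> \<F>"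
      by (auto simp: subset_chain_def)
    have "disjnt U V" if "U \<in> \<F>" "\<F> \<in> \<C>" "V \<in> \<G>" "\<G> \<in> \<C>" "U \<noteq> V" for U V \<F> \<G>
    proof -
      obtain \<H> where "\<H> \<in> \<C>" "U \<in> \<H>" "V \<in> \<H>"
        using lin \<open>U \<in> \<F>\<close> \<open>\<F> \<in> \<C>\<close> \<open>V \<in> \<G>\<close> \<open>\<G> \<in> \<C>\<close> by blast
      moreover have "pairwise disjnt \<H>"
        using sub \<open>\<H> \<in> \<C>\<close> by (auto simp: \<A>_def cellular_family_def)
      ultimately show ?thesis
        using \<open>U \<noteq> V\<close> by (auto simp: pairwise_def)
    qed
    then have "pairwise disjnt (\<Union>\<C>)"
      unfolding pairwise_def by blast
    then show "\<Union>\<C> \<in> \<A>"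
      using sub by (auto simp: \<A>_def cellular_family_def)
  qed
  then obtain \<F> where "\<F> \<in> \<A>" and max: "\<And>\<W>. \<W> \<in> \<A> \<Longrightarrow> \<F> \<subseteq> \<W> \<Longrightarrow> \<W> = \<F>"
    by blast
  then have cell: "cellular_family X \<F>" and P: "\<And>V. V \<in> \<F> \<Longrightarrow> P V"
    by (auto simp: \<A>_def)
  have "\<W> = \<F>" if \<W>: "cellular_family X \<W>" "\<F> \<subseteq> \<W>" for \<W>
  proof (rule ccontr)
    assume "\<W> \<noteq> \<F>"
    then obtain U where U: "U \<in> \<W>" "U \<notin> \<F>"
      using \<W>(2) by blast
    then have "openin X U" "U \<noteq> {}"
      using \<W>(1) by (auto simp: cellular_family_def)
    then obtain V where V: "openin X V" "V \<noteq> {}" "V \<subseteq> U" "P V"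
      using base by blast
    have disj: "disjnt V W" if "W \<in> \<F>" for W
    proof -
      have "W \<in> \<W>" "U \<noteq> W"
        using \<W>(2) U(2) that by auto
      then have "disjnt U W"
        using \<W>(1) U(1) by (simp add: cellular_family_def pairwise_def)
      then show ?thesis
        using V(3) by (auto simp: disjnt_def)
    qed
    have "insert V \<F> \<in> \<A>"
      using cell P V disj
      by (auto simp: \<A>_def cellular_family_def pairwise_insert disjnt_sym)
    then have "V \<in> \<F>"
      using max by blast
    then show False
      using disj V(2) by (auto simp: disjnt_def)
  qed
  then have "\<F> \<in> max_cellular X"
    using cell by (simp add: max_cellular_def)
  then show ?thesis
    using P by blast
qed

section \<open>The open-open game\<close>

text \<open>A strategy of the chooser maps the list of the shrinker's earlier answers to an open set.
  It is required to name a non-empty open set even at lists that no play produces, so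
  that it can be consulted without checking that a list is a legal position.\<close>

definition open_open_winning :: "'a topology \<Rightarrow> ('a set list \<Rightarrow> 'a set) \<Rightarrow> bool" where
  "open_open_winning X \<tau> \<longleftrightarrow>
     (\<forall>s. openin X (\<tau> s) \<and> \<tau> s \<noteq> {}) \<and>
     (\<forall>V. (\<forall>n. openin X (V n) \<and> V n \<noteq> {} \<and> V n \<subseteq> \<tau> (map V [0..<n])) \<longrightarrow>
          X closure_of (\<Union>n. V n) = topspace X)"

text \<open>Player two imagines a run of the open-open game: the member of player one's family that
  meets the chooser's set is the reply, and its trace on that set is passed on as the shrinker's
  answer. The replies contain the answers, so their union is dense as well.\<close>

lemma player_two_wins_if_open_open_winning:
  assumes "open_open_winning X \<tau>"
  shows "player_two_wins_G1_omega (max_cellular X) (dense_open_families X)"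
proof -
  have \<tau>: "openin X (\<tau> s)" "\<tau> s \<noteq> {}" for s
    using assms by (auto simp: open_open_winning_def)
  define pick where "pick \<F> s = (SOME W. W \<in> \<F> \<and> W \<inter> \<tau> s \<noteq> {})" for \<F> s
  have pick: "pick \<F> s \<in> \<F>" "pick \<F> s \<inter> \<tau> s \<noteq> {}" if "\<F> \<in> max_cellular X" for \<F> s
    using someI_ex[of "\<lambda>W. W \<in> \<F> \<and> W \<inter> \<tau> s \<noteq> {}"] max_cellular_meets[OF that \<tau>[of s]]
    by (auto simp: pick_def)
  define answers where "answers = responses (\<lambda>s \<F>. pick \<F> s \<inter> \<tau> s)"
  define \<sigma> where "\<sigma> fs = pick (last fs) (answers (butlast fs))" for fs
  have "winning_strategy_two (max_cellular X) (dense_open_families X) \<sigma>"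
    unfolding winning_strategy_two_def
  proof (intro allI impI)
    fix \<U> :: "nat \<Rightarrow> 'a set set" assume \<U>: "\<forall>n. \<U> n \<in> max_cellular X"
    have rep: "reply \<sigma> \<U> n = pick (\<U> n) (answers (map \<U> [0..<n]))" for n
      by (simp add: reply_def \<sigma>_def)
    define V where "V n = reply \<sigma> \<U> n \<inter> \<tau> (answers (map \<U> [0..<n]))" for n
    have ans: "answers (map \<U> [0..<n]) = map V [0..<n]" for n
      unfolding V_def rep unfolding answers_def by (subst responses_upt) (rule refl)
    have mem: "reply \<sigma> \<U> n \<in> \<U> n" for n
      using pick \<U> by (simp add: rep)
    have op: "openin X (reply \<sigma> \<U> n)" for n
      using mem[of n] \<U> by (auto simp: max_cellular_def cellular_family_def)
    have "openin X (V n) \<and> V n \<noteq> {} \<and> V n \<subseteq> \<tau> (map V [0..<n])" for n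
    proof (intro conjI)
      show "openin X (V n)"
        using op \<tau> by (simp add: V_def openin_Int)
      show "V n \<noteq> {}"
        using pick(2) \<U> by (simp add: V_def rep)
      show "V n \<subseteq> \<tau> (map V [0..<n])"
        unfolding ans[symmetric] by (simp add: V_def)
    qed
    then have "X closure_of (\<Union>n. V n) = topspace X"
      using assms by (simp add: open_open_winning_def)
    moreover have "(\<Union>n. V n) \<subseteq> \<Union>{reply \<sigma> \<U> n |n. True}"
      by (auto simp: V_def)
    ultimately have "X closure_of \<Union>{reply \<sigma> \<U> n |n. True} = topspace X"
      using closure_of_mono closure_of_subset_topspace by (metis subset_antisym)
    then show "(\<forall>n. reply \<sigma> \<U> n \<in> \<U> n) \<and> {reply \<sigma> \<U> n |n. True} \<in> dense_open_families X"
      using mem op by (auto simp: dense_open_families_def)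
  qed
  then show ?thesis
    by (auto simp: player_two_wins_G1_omega_def)
qed

lemma winning_strategy_two_legal:
  assumes "winning_strategy_two \<A> \<B> \<sigma>" "set s \<subseteq> \<A>" "\<F> \<in> \<A>"
  shows "\<sigma> (s @ [\<F>]) \<in> \<F>"
proof -
  define \<U> where "\<U> n = (if n < length s then s ! n else \<F>)" for n
  have "\<U> n \<in> \<A>" for n
    using assms(2,3) by (auto simp: \<U>_def)
  then have "reply \<sigma> \<U> (length s) \<in> \<U> (length s)"
    using assms(1) by (simp add: winning_strategy_two_def)
  moreover have "map \<U> [0..<length s] = s"
    by (rule nth_equalityI) (simp_all add: \<U>_def)
  ultimately show ?thesis
    by (simp add: reply_def \<U>_def)
qed

text \<open>Player two cannot win on the empty space, where player one may play the empty family.\<close>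

lemma player_two_wins_nonempty:
  assumes "player_two_wins_G1_omega (max_cellular X) \<B>"
  shows "topspace X \<noteq> {}"
proof
  assume "topspace X = {}"
  then have "cellular_family X \<W> \<longleftrightarrow> \<W> = {}" for \<W>
    by (auto simp: cellular_family_def dest: openin_subset)
  then have "{} \<in> max_cellular X"
    by (simp add: max_cellular_def)
  moreover obtain \<sigma> where "winning_strategy_two (max_cellular X) \<B> \<sigma>"
    using assms by (auto simp: player_two_wins_G1_omega_def)
  ultimately show False
    using winning_strategy_two_legal[of _ _ \<sigma> "[]"] by force
qed

text \<open>Here the chooser imagines the game on families: \<open>U s\<close> is chosen so that each legal answer is player
  two's reply to some family, and that family extends the imagined position \<open>s\<close>.\<close>

lemma open_open_winning_if_player_two_wins:
  assumes "player_two_wins_G1_omega (max_cellular X) (dense_open_families X)"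
  shows "\<exists>\<tau>. open_open_winning X \<tau>"
proof -
  let ?C = "max_cellular X"
  obtain \<sigma> where \<sigma>: "winning_strategy_two ?C (dense_open_families X) \<sigma>"
    using assms by (auto simp: player_two_wins_G1_omega_def)
  define is_reply where "is_reply s V \<longleftrightarrow> (\<exists>\<F>\<in>?C. \<sigma> (s @ [\<F>]) = V)" for s V
  define replied where "replied s U \<longleftrightarrow> openin X U \<and> U \<noteq> {} \<and>
      (set s \<subseteq> ?C \<longrightarrow> (\<forall>V. openin X V \<longrightarrow> V \<noteq> {} \<longrightarrow> V \<subseteq> U \<longrightarrow> is_reply s V))" for s U
  have "\<exists>U. replied s U" for s
  proof (cases "set s \<subseteq> ?C")
    case True
    show ?thesis
    proof (rule ccontr)
      assume none: "\<nexists>U. replied s U"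
      have "\<exists>V. openin X V \<and> V \<noteq> {} \<and> V \<subseteq> U \<and> \<not> is_reply s V"
        if "openin X U" "U \<noteq> {}" for U
      proof -
        have "\<not> replied s U"
          using none by simp
        then show ?thesis
          using that unfolding replied_def by metis
      qed
      then have "\<exists>\<F>\<in>?C. \<forall>V\<in>\<F>. \<not> is_reply s V"
        by (rule max_cellular_within_pi_base)
      then obtain \<F> where \<F>: "\<F> \<in> ?C" "\<forall>V\<in>\<F>. \<not> is_reply s V"
        by (elim bexE)
      have "\<sigma> (s @ [\<F>]) \<in> \<F>"
        by (rule winning_strategy_two_legal[OF \<sigma> True \<F>(1)])
      moreover have "is_reply s (\<sigma> (s @ [\<F>]))"
        using \<F>(1) unfolding is_reply_def by blast
      ultimately show False
        using \<F>(2) by simp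
    qed
  next
    case False
    then have "replied s (topspace X)"
      using player_two_wins_nonempty[OF assms] by (simp add: replied_def)
    then show ?thesis ..
  qed
  then have "\<exists>U. \<forall>s. replied s (U s)"
    by (intro choice allI)
  then obtain U where replied: "\<And>s. replied s (U s)"
    by blast
  have U: "openin X (U s)" "U s \<noteq> {}" for s
    using replied[of s] by (simp_all add: replied_def)
  have U_reply: "is_reply s V"
    if "set s \<subseteq> ?C" "openin X V" "V \<noteq> {}" "V \<subseteq> U s" for s V
    using replied[of s] that by (simp add: replied_def)
  define fam where "fam s V = (SOME \<F>. \<F> \<in> ?C \<and> \<sigma> (s @ [\<F>]) = V)" for s V
  define fams where "fams = responses fam"
  have "open_open_winning X (\<lambda>vs. U (fams vs))"
    unfolding open_open_winning_def
  proof (intro conjI allI impI)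
    fix V
    assume V: "\<forall>n. openin X (V n) \<and> V n \<noteq> {} \<and> V n \<subseteq> U (fams (map V [0..<n]))"
    define \<U> where "\<U> n = fam (fams (map V [0..<n])) (V n)" for n
    have fams: "fams (map V [0..<n]) = map \<U> [0..<n]" for n
      unfolding \<U>_def unfolding fams_def by (subst responses_upt) (rule refl)
    have \<U>: "\<U> n \<in> ?C \<and> \<sigma> (map \<U> [0..<n] @ [\<U> n]) = V n" for n
    proof (induction n rule: less_induct)
      case (less n)
      then have "set (map \<U> [0..<n]) \<subseteq> ?C"
        by auto
      then have "\<exists>\<F>. \<F> \<in> ?C \<and> \<sigma> (map \<U> [0..<n] @ [\<F>]) = V n"
        using U_reply[of "map \<U> [0..<n]" "V n"] V by (auto simp: fams is_reply_def)
      then show ?case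
        using someI_ex[of "\<lambda>\<F>. \<F> \<in> ?C \<and> \<sigma> (map \<U> [0..<n] @ [\<F>]) = V n"]
        by (simp add: \<U>_def[of n] fams fam_def)
    qed
    then have "reply \<sigma> \<U> = V"
      by (simp add: reply_def fun_eq_iff)
    moreover have "{reply \<sigma> \<U> n |n. True} \<in> dense_open_families X"
      using \<sigma> \<U> by (simp add: winning_strategy_two_def)
    ultimately have "{V n |n. True} \<in> dense_open_families X"
      by simp
    moreover have "\<Union>{V n |n. True} = (\<Union>n. V n)"
      by auto
    ultimately show "X closure_of (\<Union>n. V n) = topspace X"
      by (simp add: dense_open_families_def)
  qed (use U in auto)
  then show ?thesis
    by blast
qed

section \<open>Trees of plays in a factor\<close>

text \<open>\<open>W n\<close> is the answer of inning \<open>n\<close> in the factor \<open>X\<close>, and \<open>taken n s\<close> says that inning \<open>n\<close> extends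
  the partial play with the moves \<open>W m\<close>, \<open>m\<close> in \<open>s\<close>. If every node had an extension that misses \<open>A\<close>,
  iterating from the empty node would give a legal play whose union misses \<open>A\<close>.\<close>

lemma decisive_node:
  assumes win: "open_open_winning X \<tau>"
    and W: "\<And>n. openin X (W n) \<and> W n \<noteq> {}"
    and legal: "\<And>n s. taken n s \<Longrightarrow> W n \<subseteq> \<tau> (map W s)"
    and A: "openin X A" "A \<noteq> {}"
  shows "\<exists>s. \<forall>n. taken n s \<longrightarrow> W n \<inter> A \<noteq> {}"
proof (rule ccontr)
  assume "\<not> ?thesis"
  then obtain g where g: "\<And>s. taken (g s) s" "\<And>s. W (g s) \<inter> A = {}"
    by metis
  \<comment> \<open>The branch \<open>b 0, b 1, \<dots>\<close> is generated by \<open>g\<close> alone; the input list of \<open>responses\<close> only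
    counts its length.\<close>
  define node where "node n = responses (\<lambda>s _. g s) (map (\<lambda>_. ()) [0..<n])" for n :: nat
  define b where "b n = g (node n)" for n
  have node: "node n = map b [0..<n]" for n
    unfolding b_def unfolding node_def by (subst responses_upt) (rule refl)
  have "W (b n) \<subseteq> \<tau> (map (\<lambda>k. W (b k)) [0..<n])" for n
  proof -
    have "W (b n) \<subseteq> \<tau> (map W (node n))"
      using legal[OF g(1)] by (simp add: b_def)
    then show ?thesis
      by (simp add: node comp_def)
  qed
  then have "X closure_of (\<Union>n. W (b n)) = topspace X"
    using win W by (simp add: open_open_winning_def)
  then have "(\<Union>n. W (b n)) \<inter> A \<noteq> {}"
    using A by (simp add: dense_intersects_open)
  then show False
    using g(2) by (auto simp: b_def)
qed

section \<open>The open-open game on a product\<close>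

lemma open_contains_box:
  assumes "openin (product_topology X I) V" "V \<noteq> {}"
  shows "\<exists>B. (\<forall>i\<in>I. openin (X i) (B i) \<and> B i \<noteq> {}) \<and>
             finite {i\<in>I. B i \<noteq> topspace (X i)} \<and> PiE I B \<subseteq> V"
proof -
  obtain x where "x \<in> V"
    using assms(2) by blast
  then obtain B where "finite {i\<in>I. B i \<noteq> topspace (X i)}" "\<forall>i\<in>I. openin (X i) (B i)"
      "x \<in> PiE I B" "PiE I B \<subseteq> V"
    using assms(1) unfolding openin_product_topology_alt by blast
  then show ?thesis
    by (intro exI[of _ B]) auto
qed

lemma open_open_winning_product:
  fixes X :: "'i \<Rightarrow> 'a topology" and I :: "'i set"
  assumes win: "\<And>i. i \<in> I \<Longrightarrow> open_open_winning (X i) (\<tau> i)"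
  shows "\<exists>\<rho>. open_open_winning (product_topology X I) \<rho>"
proof -
  let ?X = "product_topology X I"
  have \<tau>: "openin (X i) (\<tau> i s)" "\<tau> i s \<noteq> {}" if "i \<in> I" for i s
    using win[OF that] by (auto simp: open_open_winning_def)
  obtain box where box: "\<And>V. openin ?X V \<Longrightarrow> V \<noteq> {} \<Longrightarrow>
      (\<forall>i\<in>I. openin (X i) (box V i) \<and> box V i \<noteq> {}) \<and>
      finite {i\<in>I. box V i \<noteq> topspace (X i)} \<and> PiE I (box V) \<subseteq> V"
    using open_contains_box[of X I] by metis
  define supp where "supp V = {i\<in>I. box V i \<noteq> topspace (X i)}" for V

  \<comment> \<open>A request is a list of entries \<open>((m, k), s)\<close>, asking for the node \<open>s\<close> at the \<open>k\<close>-th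
    coordinate in the support of the \<open>m\<close>-th answer. Requests form a countable type, fixed before the
    play starts, although the coordinates they refer to are revealed only by the play.
    Inning \<open>n\<close> serves the request coded by the first component of the pair coded by \<open>n\<close>, so
    every request is served infinitely often.\<close>
  define request :: "nat \<Rightarrow> ((nat \<times> nat) \<times> nat list) list"
    where "request n = from_nat (fst (prod_decode n))" for n
  define nodes :: "('i \<Rightarrow> 'a) set list \<Rightarrow> 'i \<rightharpoonup> nat list"
    where "nodes vs = map_of (map (\<lambda>((m, k), s). (from_nat_into (supp (vs ! m)) k, s))
                                   (request (length vs)))" for vs
  define side where "side vs i =
      (case nodes vs i of None \<Rightarrow> topspace (X i)
       | Some s \<Rightarrow> \<tau> i (map (\<lambda>m. box (vs ! m) i) s))" for vs i
  have side: "openin (X i) (side vs i)" "side vs i \<noteq> {}" if "i \<in> I" for vs i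
    using \<tau>[OF that] openin_subset[OF \<tau>(1)[OF that]]
    by (auto simp: side_def split: option.split)
  have "open_open_winning ?X (\<lambda>vs. PiE I (side vs))"
    unfolding open_open_winning_def
  proof (intro conjI allI impI)
    fix vs
    have "finite {i \<in> I. side vs i \<noteq> topspace (X i)}"
      by (rule finite_subset[of _ "dom (nodes vs)"])
        (auto simp: side_def nodes_def finite_dom_map_of split: option.splits)
    then show "openin ?X (PiE I (side vs))"
      using side by (simp add: openin_PiE_gen)
    show "PiE I (side vs) \<noteq> {}"
      using side by (simp add: PiE_eq_empty_iff)
  next
    fix V
    assume V: "\<forall>n. openin ?X (V n) \<and> V n \<noteq> {} \<and> V n \<subseteq> PiE I (side (map V [0..<n]))"
    have boxV: "openin (X i) (box (V n) i)" "box (V n) i \<noteq> {}" if "i \<in> I" for i n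
      using box[of "V n"] V that by auto
    have V_box: "PiE I (box (V n)) \<subseteq> V n" and fin: "finite (supp (V n))" for n
      using box[of "V n"] V by (auto simp: supp_def)
    have box_side: "box (V n) i \<subseteq> side (map V [0..<n]) i" if "i \<in> I" for i n
    proof -
      have "PiE I (box (V n)) \<noteq> {}"
        using boxV by (simp add: PiE_eq_empty_iff)
      moreover have "PiE I (box (V n)) \<subseteq> PiE I (side (map V [0..<n]))"
        using V_box V by blast
      ultimately show ?thesis
        using that by (simp add: subset_PiE)
    qed
    define taken where "taken i n s \<longleftrightarrow> nodes (map V [0..<n]) i = Some s \<and> set s \<subseteq> {..<n}"
      for i n s
    have legal: "box (V n) i \<subseteq> \<tau> i (map (\<lambda>m. box (V m) i) s)" if "i \<in> I" "taken i n s" for i n s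
    proof -
      have "map (\<lambda>m. box (map V [0..<n] ! m) i) s = map (\<lambda>m. box (V m) i) s"
        using that(2) by (auto simp: taken_def)
      moreover have "side (map V [0..<n]) i = \<tau> i (map (\<lambda>m. box (map V [0..<n] ! m) i) s)"
        using that(2) by (simp add: side_def taken_def)
      ultimately show ?thesis
        using box_side[OF that(1), of n] by (simp only:)
    qed
    have "(\<Union>n. V n) \<inter> T \<noteq> {}" if T: "openin ?X T" "T \<noteq> {}" for T
    proof -
      have boxT: "openin (X i) (box T i)" "box T i \<noteq> {}" if "i \<in> I" for i
        using box[OF T] that by auto
      define F where "F = supp T \<inter> (\<Union>n. supp (V n))"
      have "F \<subseteq> I" "finite F"
        using box[OF T] by (auto simp: F_def supp_def)
      have "\<exists>s. \<forall>n. taken i n s \<longrightarrow> box (V n) i \<inter> box T i \<noteq> {}" if "i \<in> I" for i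
        using that boxV boxT legal
        by (intro decisive_node[OF win[OF that]]) auto
      then obtain d where d: "\<And>i n. i \<in> I \<Longrightarrow> taken i n (d i) \<Longrightarrow> box (V n) i \<inter> box T i \<noteq> {}"
        by metis
      have "\<exists>m k. from_nat_into (supp (V m)) k = i" if i: "i \<in> F" for i
      proof -
        obtain m where "i \<in> supp (V m)"
          using i by (auto simp: F_def)
        moreover have "countable (supp (V m))"
          using fin by (simp add: countable_finite)
        ultimately show ?thesis
          using from_nat_into_surj by metis
      qed
      then obtain M K where code: "\<And>i. i \<in> F \<Longrightarrow> from_nat_into (supp (V (M i))) (K i) = i"
        by metis
      obtain xs where xs: "set xs = F"
        using \<open>finite F\<close> finite_list by blast
      define r where "r = map (\<lambda>i. ((M i, K i), d i)) xs"
      \<comment> \<open>The request has to be served after all answers that it refers to.\<close>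
      have "finite (M ` F \<union> (\<Union>i\<in>F. set (d i)))"
        using \<open>finite F\<close> by simp
      then obtain b where b: "M ` F \<union> (\<Union>i\<in>F. set (d i)) \<subseteq> {..<b}"
        using finite_nat_iff_bounded by blast
      define n where "n = prod_encode (to_nat r, b)"
      have "b \<le> n"
        by (simp add: n_def le_prod_encode_2)
      then have before: "M i < n" "set (d i) \<subseteq> {..<n}" if "i \<in> F" for i
        using b that by fastforce+
      have "request n = r"
        by (simp add: request_def n_def)
      then have "nodes (map V [0..<n]) =
          map_of (map (\<lambda>i. (from_nat_into (supp (map V [0..<n] ! M i)) (K i), d i)) xs)"
        by (simp add: nodes_def r_def comp_def)
      also have "map (\<lambda>i. (from_nat_into (supp (map V [0..<n] ! M i)) (K i), d i)) xs
          = map (\<lambda>i. (i, d i)) xs"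
        using before(1) code xs by simp
      finally have "taken i n (d i)" if "i \<in> F" for i
        using that before(2) xs by (simp add: taken_def map_of_map_restrict)
      then have meetF: "box (V n) i \<inter> box T i \<noteq> {}" if "i \<in> F" for i
        using d that \<open>F \<subseteq> I\<close> by blast
      have "box (V n) i \<inter> box T i \<noteq> {}" if "i \<in> I" for i
      proof (cases "i \<in> F")
        case False
        then have "box (V n) i = topspace (X i) \<or> box T i = topspace (X i)"
          using that by (auto simp: F_def supp_def)
        then show ?thesis
          using boxV[OF that, of n] boxT[OF that] openin_subset by blast
      qed (use meetF in blast)
      then have "PiE I (box (V n)) \<inter> PiE I (box T) \<noteq> {}"
        by (simp add: PiE_Int PiE_eq_empty_iff)
      moreover have "PiE I (box (V n)) \<subseteq> V n" "PiE I (box T) \<subseteq> T"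
        using V_box box[OF T] by auto
      ultimately show ?thesis
        by blast
    qed
    then show "?X closure_of (\<Union>n. V n) = topspace ?X"
      unfolding dense_intersects_open by blast
  qed
  then show ?thesis
    by blast
qed

theorem theorem3p9:
  fixes X :: "'i \<Rightarrow> 'a topology" and I :: "'i set"
  assumes "\<And>i. i \<in> I \<Longrightarrow> countable_pi_character (X i)"
    and "\<And>i. i \<in> I \<Longrightarrow>
           player_two_wins_G1_omega (max_cellular (X i)) (dense_open_families (X i))"
  shows "player_two_wins_G1_omega
           (max_cellular (product_topology X I)) (dense_open_families (product_topology X I))"
proof -
  obtain \<tau> where "\<And>i. i \<in> I \<Longrightarrow> open_open_winning (X i) (\<tau> i)"
    using open_open_winning_if_player_two_wins[OF assms(2)] by metis
  then obtain \<rho> where "open_open_winning (product_topology X I) \<rho>"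
    using open_open_winning_product by blast
  then show ?thesis
    by (rule player_two_wins_if_open_open_winning)
qed

end
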